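(* For any argumentation framework $\Lambda=\langle A,R\rangle$, semantics $\sigma\in\{\mathtt{co},\mathtt{st},\mathtt{pr},\mathtt{sst}\}$, goal $g\in A$, and $\sigma$-labelling $\mathcal{L}\in\sigma(\Lambda)$: (1) $\mathcal{CF}^{\sigma}(g,\mathcal{L})=\mathtt{mc}\text{-}\sigma\big(\langle A,R,\{\neg\,\ell(\mathcal{L},g)\},\{\ell(\mathcal{L},a)\mid a\in A\setminus\{g\}\}\rangle\big)$; (2) $\mathcal{SF}^{\sigma}(g,\mathcal{L})=\mathtt{mc}\text{-}\sigma\big(\langle A,R,\{\ell(\mathcal{L},g)\},\{\neg\,\ell(\mathcal{L},a)\mid a\in A\setminus\{g\}\}\rangle\big)$.
   Context: An argumentation framework (AF) is a pair $\Lambda=\langle A,R\rangle$ with $A$ a (finite) set of arguments and $R\subseteq A\times A$ a set of attacks. For $S\subseteq A$ let $\mathit{Def}(S)=\{a\in A\mid \exists b\in S,\ (b,a)\in R\}$ and $\mathit{Acc}(S)=\{a\in A\mid \forall (b,a)\in R,\ b\in \mathit{Def}(S)\}$. $S$ is conflict-free iff $S\cap \mathit{Def}(S)=\emptyset$, and admissible iff it is conflict-free and $S\subseteq \mathit{Acc}(S)$. A set $S\subseteq A$ is an extension called: complete ($\mathtt{co}$) iff it is admissible and $S=\mathit{Acc}(S)$; preferred ($\mathtt{pr}$) iff it is a $\subseteq$-maximal complete extension; stable ($\mathtt{st}$) iff it is a preferred extension with $S\cup \mathit{Def}(S)=A$; semi-stable ($\mathtt{sst}$) iff it is a preferred extension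 such that $S\cup \mathit{Def}(S)$ is $\subseteq$-maximal (among preferred extensions). A labelling is a total function $\mathcal{L}:A\to\{\mathbf{in},\mathbf{out},\mathbf{und}\}$. The labelling corresponding to an extension $E$ assigns $\mathbf{in}$ to the elements of $E$, $\mathbf{out}$ to the elements of $\mathit{Def}(E)$, and $\mathbf{und}$ to all other arguments. A $\sigma$-labelling of $\Lambda$ is the labelling corresponding to a $\sigma$-extension of $\Lambda$; $\sigma(\Lambda)$ denotes the set of $\sigma$-labellings of $\Lambda$. The distance between labellings is $\delta(\mathcal{L},\mathcal{L}')=|\{a\in A\mid \mathcal{L}(a)\neq\mathcal{L}'(a)\}|$. Counterfactuals: $\mathcal{CF}^{\sigma}(g,\mathcal{L})$ is the set of $\mathcal{L}'\in\sigma(\Lambda)$ such that (i) $\mathcal{L}(g)\neq\mathcal{L}'(g)$, and (ii) there is no $\mathcal{L}''\in\sigma(\Lambda)$ with $\mathcal{L}(g)\neq\mathcal{L}''(g)$ and $\delta(\mathcal{L},\mathcal{L}'')<\delta(\mathcal{L},\mathcal{L}')$. Semifactuals: $\mathcal{SF}^{\sigma}(g,\mathcal{L})$ is the set of $\mathcal{L}'\in\sigma(\Lambda)$ such that (i) $\mathcal{L}(g)=\mathcal{L}'(g)$, and (ii) there is no $\mathcal{L}''\in\sigma(\Lambda)$ with $\mathcal{L}(g)=\mathcal{L}''(g)$ and $\delta(\mathcal{L},\mathcal{L}'')>\delta(\mathcal{L},\mathcal{L}')$. A Weak constrained AF (WAF) is a quadruple $\langle A,R,\mathcal{C},\mathcal{W}\rangle$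 where $\langle A,R\rangle$ is an AF and $\mathcal{C}$ (strong constraints) and $\mathcal{W}$ (weak constraints) are sets of propositional formulae built with $\neg,\vee,\wedge$ from the atoms $\lambda_A=\{\mathbf{in}(a),\mathbf{out}(a),\mathbf{und}(a)\mid a\in A\}$. For a labelling $\mathcal{L}$ and $a\in A$, $\ell(\mathcal{L},a)\in\lambda_A$ is the atom $\mathbf{in}(a)$, $\mathbf{out}(a)$ or $\mathbf{und}(a)$ according to whether $\mathcal{L}(a)=\mathbf{in}$, $\mathbf{out}$ or $\mathbf{und}$. A labelling $\mathcal{L}$ satisfies a formula $\kappa$ ($\mathcal{L}\models\kappa$) iff $\kappa$ evaluates to true when the atoms in $\{\ell(\mathcal{L},a)\mid a\in A\}$ are set to true and all other atoms are set to false; $\mathcal{L}$ satisfies a set of formulae iff it satisfies each of its members. For a WAF $\Upsilon=\langle A,R,\mathcal{C},\mathcal{W}\rangle$, $\mathtt{mc}\text{-}\sigma(\Upsilon)$ denotes the set of maximum-cardinality $\sigma$-labellings of $\Upsilon$: those $\sigma$-labellings $\mathcal{L}$ of $\langle A,R\rangle$ such that $\mathcal{L}\models\mathcal{C}$ and, with $\mathcal{W}_{\mathcal{L}}\subseteq\mathcal{W}$ the set of weak constraints satisfied by $\mathcal{L}$, there is no $\sigma$-labelling $\mathcal{L}'$ of $\langle A,R\rangle$ with $\mathcal{L}'\models\mathcal{C}$ and $|\mathcal{W}_{\mathcal{L}}|<|\mathcal{W}_{\mathcal{L}'}|$. *)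

theory Defs
  imports "HOL-Library.FuncSet"
begin

definition argumentation_framework :: "'a set \<Rightarrow> ('a \<times> 'a) set \<Rightarrow> bool" where
  "argumentation_framework A R \<longleftrightarrow> finite A \<and> R \<subseteq> A \<times> A"

definition defeated :: "'a set \<Rightarrow> ('a \<times> 'a) set \<Rightarrow> 'a set \<Rightarrow> 'a set" where
  "defeated A R S = {a \<in> A. \<exists>b\<in>S. (b, a) \<in> R}"

definition acceptable :: "'a set \<Rightarrow> ('a \<times> 'a) set \<Rightarrow> 'a set \<Rightarrow> 'a set" where
  "acceptable A R S = {a \<in> A. \<forall>b. (b, a) \<in> R \<longrightarrow> b \<in> defeated A R S}"

definition conflict_free :: "'a set \<Rightarrow> ('a \<times> 'a) set \<Rightarrow> 'a set \<Rightarrow> bool" where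
  "conflict_free A R S \<longleftrightarrow> S \<subseteq> A \<and> S \<inter> defeated A R S = {}"

definition admissible :: "'a set \<Rightarrow> ('a \<times> 'a) set \<Rightarrow> 'a set \<Rightarrow> bool" where
  "admissible A R S \<longleftrightarrow> conflict_free A R S \<and> S \<subseteq> acceptable A R S"

definition complete_ext :: "'a set \<Rightarrow> ('a \<times> 'a) set \<Rightarrow> 'a set \<Rightarrow> bool" where
  "complete_ext A R S \<longleftrightarrow> admissible A R S \<and> S = acceptable A R S"

definition preferred_ext :: "'a set \<Rightarrow> ('a \<times> 'a) set \<Rightarrow> 'a set \<Rightarrow> bool" where
  "preferred_ext A R S \<longleftrightarrow>
     complete_ext A R S \<and> \<not> (\<exists>T. complete_ext A R T \<and> S \<subset> T)"

definition stable_ext :: "'a set \<Rightarrow> ('a \<times> 'a) set \<Rightarrow> 'a set \<Rightarrow> bool" where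
  "stable_ext A R S \<longleftrightarrow> preferred_ext A R S \<and> S \<union> defeated A R S = A"

definition semi_stable_ext :: "'a set \<Rightarrow> ('a \<times> 'a) set \<Rightarrow> 'a set \<Rightarrow> bool" where
  "semi_stable_ext A R S \<longleftrightarrow>
     preferred_ext A R S \<and>
     \<not> (\<exists>T. preferred_ext A R T \<and> S \<union> defeated A R S \<subset> T \<union> defeated A R T)"

datatype semantics = Complete | Stable | Preferred | Semi_Stable

fun is_extension :: "semantics \<Rightarrow> 'a set \<Rightarrow> ('a \<times> 'a) set \<Rightarrow> 'a set \<Rightarrow> bool" where
  "is_extension Complete = complete_ext"
| "is_extension Stable = stable_ext"
| "is_extension Preferred = preferred_ext"
| "is_extension Semi_Stable = semi_stable_ext"

datatype label = IN | OUT | UND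

(* A labelling is a total function on A only. It is represented as an element of
   extensional A, so that two labellings are equal as HOL functions iff they agree on A. *)
definition labelling_of :: "'a set \<Rightarrow> ('a \<times> 'a) set \<Rightarrow> 'a set \<Rightarrow> 'a \<Rightarrow> label" where
  "labelling_of A R E =
     (\<lambda>a\<in>A. if a \<in> E then IN else if a \<in> defeated A R E then OUT else UND)"

definition labellings :: "semantics \<Rightarrow> 'a set \<Rightarrow> ('a \<times> 'a) set \<Rightarrow> ('a \<Rightarrow> label) set" where
  "labellings \<sigma> A R = {labelling_of A R E | E. is_extension \<sigma> A R E}"

definition distance :: "'a set \<Rightarrow> ('a \<Rightarrow> label) \<Rightarrow> ('a \<Rightarrow> label) \<Rightarrow> nat" where
  "distance A L L' = card {a \<in> A. L a \<noteq> L' a}"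

definition counterfactuals ::
  "semantics \<Rightarrow> 'a set \<Rightarrow> ('a \<times> 'a) set \<Rightarrow> 'a \<Rightarrow> ('a \<Rightarrow> label) \<Rightarrow> ('a \<Rightarrow> label) set" where
  "counterfactuals \<sigma> A R g L =
     {L' \<in> labellings \<sigma> A R. L g \<noteq> L' g \<and>
        \<not> (\<exists>L''\<in>labellings \<sigma> A R. L g \<noteq> L'' g \<and> distance A L L'' < distance A L L')}"

definition semifactuals ::
  "semantics \<Rightarrow> 'a set \<Rightarrow> ('a \<times> 'a) set \<Rightarrow> 'a \<Rightarrow> ('a \<Rightarrow> label) \<Rightarrow> ('a \<Rightarrow> label) set" where
  "semifactuals \<sigma> A R g L =
     {L' \<in> labellings \<sigma> A R. L g = L' g \<and>
        \<not> (\<exists>L''\<in>labellings \<sigma> A R. L g = L'' g \<and> distance A L L'' > distance A L L')}"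

datatype 'a atom = In 'a | Out 'a | Und 'a

datatype 'p formula =
    Atom 'p
  | Neg "'p formula"
  | Disj "'p formula" "'p formula"
  | Conj "'p formula" "'p formula"

fun eval_formula :: "'p set \<Rightarrow> 'p formula \<Rightarrow> bool" where
  "eval_formula I (Atom p) \<longleftrightarrow> p \<in> I"
| "eval_formula I (Neg \<phi>) \<longleftrightarrow> \<not> eval_formula I \<phi>"
| "eval_formula I (Disj \<phi> \<psi>) \<longleftrightarrow> eval_formula I \<phi> \<or> eval_formula I \<psi>"
| "eval_formula I (Conj \<phi> \<psi>) \<longleftrightarrow> eval_formula I \<phi> \<and> eval_formula I \<psi>"

definition atoms_over :: "'a set \<Rightarrow> 'a atom set" where
  "atoms_over A = In ` A \<union> Out ` A \<union> Und ` A"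

fun label_atom :: "label \<Rightarrow> 'a \<Rightarrow> 'a atom" where
  "label_atom IN = In"
| "label_atom OUT = Out"
| "label_atom UND = Und"

definition atom_of :: "('a \<Rightarrow> label) \<Rightarrow> 'a \<Rightarrow> 'a atom" where
  "atom_of L a = label_atom (L a) a"

definition satisfies :: "'a set \<Rightarrow> ('a \<Rightarrow> label) \<Rightarrow> 'a atom formula \<Rightarrow> bool" where
  "satisfies A L \<kappa> \<longleftrightarrow> eval_formula {atom_of L a | a. a \<in> A} \<kappa>"

definition satisfies_all :: "'a set \<Rightarrow> ('a \<Rightarrow> label) \<Rightarrow> 'a atom formula set \<Rightarrow> bool" where
  "satisfies_all A L C \<longleftrightarrow> (\<forall>\<kappa>\<in>C. satisfies A L \<kappa>)"

(* Finiteness of the constraint sets is what makes the cardinalities compared in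
   mc_labellings meaningful, as card is 0 on infinite sets. *)
definition weak_constrained_af ::
  "'a set \<Rightarrow> ('a \<times> 'a) set \<Rightarrow> 'a atom formula set \<Rightarrow> 'a atom formula set \<Rightarrow> bool" where
  "weak_constrained_af A R C W \<longleftrightarrow>
     argumentation_framework A R \<and> finite C \<and> finite W \<and>
     (\<forall>\<kappa>\<in>C \<union> W. set_formula \<kappa> \<subseteq> atoms_over A)"

definition satisfied_weak ::
  "'a set \<Rightarrow> 'a atom formula set \<Rightarrow> ('a \<Rightarrow> label) \<Rightarrow> 'a atom formula set" where
  "satisfied_weak A W L = {\<kappa> \<in> W. satisfies A L \<kappa>}"

definition mc_labellings ::
  "semantics \<Rightarrow> 'a set \<Rightarrow> ('a \<times> 'a) set \<Rightarrow> 'a atom formula set \<Rightarrow> 'a atom formula set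
     \<Rightarrow> ('a \<Rightarrow> label) set" where
  "mc_labellings \<sigma> A R C W =
     {L \<in> labellings \<sigma> A R. satisfies_all A L C \<and>
        \<not> (\<exists>L'\<in>labellings \<sigma> A R. satisfies_all A L' C \<and>
              card (satisfied_weak A W L) < card (satisfied_weak A W L'))}"

lemma labellings_extensional: "L \<in> labellings \<sigma> A R \<Longrightarrow> L \<in> A \<rightarrow>\<^sub>E UNIV"
  by (auto simp: labellings_def labelling_of_def)

lemma atom_of_in_atoms_over: "a \<in> A \<Longrightarrow> atom_of L a \<in> atoms_over A"
  by (cases "L a") (auto simp: atom_of_def atoms_over_def)

(* mc_labellings does not itself require weak_constrained_af; the quadruples it is
   applied to for counterfactuals and semifactuals do satisfy it. *)
lemma weak_constrained_af_counterfactual: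
  assumes "argumentation_framework A R" and "g \<in> A"
  shows "weak_constrained_af A R {Neg (Atom (atom_of L g))} {Atom (atom_of L a) | a. a \<in> A - {g}}"
  using assms atom_of_in_atoms_over[of _ A L]
  by (auto simp: weak_constrained_af_def argumentation_framework_def)

lemma weak_constrained_af_semifactual:
  assumes "argumentation_framework A R" and "g \<in> A"
  shows "weak_constrained_af A R {Atom (atom_of L g)} {Neg (Atom (atom_of L a)) | a. a \<in> A - {g}}"
  using assms atom_of_in_atoms_over[of _ A L]
  by (auto simp: weak_constrained_af_def argumentation_framework_def)

end

theory Submission
  imports Defs
begin

text \<open>
  A labelling satisfies the atom of \<open>L\<close> at \<open>a\<close> iff it agrees with \<open>L\<close> at \<open>a\<close>, so the number of
  satisfied weak constraints counts agreements with \<open>L\<close> on \<open>A - {g}\<close> in part (1) and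
  disagreements in part (2). The strong constraint fixes whether \<open>g\<close> itself is an agreement, in
  either case so that \<open>g\<close> does not belong to the counted set. Hence the counts are
  \<open>card A - distance A L L'\<close> and \<open>distance A L L'\<close>, and maximising them amounts to minimising and
  to maximising the distance.
\<close>

text \<open>The constructors of \<open>atom\<close> are injective with disjoint ranges, so an atom
  determines both its argument and its label.\<close>

lemma atom_of_eq_iff: "atom_of L a = atom_of L' b \<longleftrightarrow> a = b \<and> L a = L' b"
  by (cases "L a"; cases "L' b") (auto simp: atom_of_def)

lemma satisfies_atom_of_iff:
  assumes "a \<in> A"
  shows "satisfies A L' (Atom (atom_of L a)) \<longleftrightarrow> L a = L' a"
  using assms by (auto simp: satisfies_def atom_of_eq_iff)

lemma satisfies_Neg: "satisfies A L (Neg \<phi>) \<longleftrightarrow> \<not> satisfies A L \<phi>"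
  by (simp add: satisfies_def)

text \<open>Weak constraints form a set; injectivity of \<open>f\<close> keeps them from collapsing,
  so arguments can be counted instead of formulae.\<close>

lemma card_satisfied_weak_image:
  assumes "inj_on f B"
  shows "card (satisfied_weak A (f ` B) L) = card {a \<in> B. satisfies A L (f a)}"
proof -
  have "satisfied_weak A (f ` B) L = f ` {a \<in> B. satisfies A L (f a)}"
    by (auto simp: satisfied_weak_def)
  then show ?thesis
    using assms by (simp add: card_image inj_on_subset)
qed

text \<open>The form as a sum avoids truncated subtraction on \<open>nat\<close>.\<close>

lemma card_satisfied_atoms:
  assumes "finite A" and "L g \<noteq> L' g"
  shows "card (satisfied_weak A {Atom (atom_of L a) | a. a \<in> A - {g}} L') + distance A L L' = card A"
proof -
  have "card (satisfied_weak A ((\<lambda>a. Atom (atom_of L a)) ` (A - {g})) L')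
      = card {a \<in> A - {g}. satisfies A L' (Atom (atom_of L a))}"
    by (intro card_satisfied_weak_image inj_onI) (simp add: atom_of_eq_iff)
  also have "{a \<in> A - {g}. satisfies A L' (Atom (atom_of L a))} = {a \<in> A. L a = L' a}"
    using assms(2) by (auto simp: satisfies_atom_of_iff)
  \<comment> \<open>Agreements and disagreements with \<open>L\<close> partition the finite set
    \<open>A\<close>.\<close>
  also have "card {a \<in> A. L a = L' a} + distance A L L' = card A"
    unfolding distance_def using assms(1)
    by (subst card_Un_disjoint[symmetric]) (auto intro: arg_cong[where f = card])
  finally show ?thesis
    by (simp only: Setcompr_eq_image)
qed

lemma card_satisfied_negated_atoms:
  assumes "L g = L' g"
  shows "card (satisfied_weak A {Neg (Atom (atom_of L a)) | a. a \<in> A - {g}} L') = distance A L L'"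
proof -
  have "card (satisfied_weak A ((\<lambda>a. Neg (Atom (atom_of L a))) ` (A - {g})) L')
      = card {a \<in> A - {g}. satisfies A L' (Neg (Atom (atom_of L a)))}"
    by (intro card_satisfied_weak_image inj_onI) (simp add: atom_of_eq_iff)
  also have "{a \<in> A - {g}. satisfies A L' (Neg (Atom (atom_of L a)))} = {a \<in> A. L a \<noteq> L' a}"
    using assms by (auto simp: satisfies_atom_of_iff satisfies_Neg)
  finally show ?thesis
    by (simp only: Setcompr_eq_image distance_def)
qed

theorem proposition1:
  fixes A :: "'a set" and R :: "('a \<times> 'a) set" and \<sigma> :: semantics
    and g :: 'a and L :: "'a \<Rightarrow> label"
  assumes "argumentation_framework A R"
    and "g \<in> A"
    and "L \<in> labellings \<sigma> A R"
  shows "counterfactuals \<sigma> A R g L =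
           mc_labellings \<sigma> A R {Neg (Atom (atom_of L g))}
             {Atom (atom_of L a) | a. a \<in> A - {g}}
       \<and> semifactuals \<sigma> A R g L =
           mc_labellings \<sigma> A R {Atom (atom_of L g)}
             {Neg (Atom (atom_of L a)) | a. a \<in> A - {g}}"
proof
  let ?W = "{Atom (atom_of L a) | a. a \<in> A - {g}}"
  have "finite A"
    using assms(1) by (simp add: argumentation_framework_def)
  \<comment> \<open>For both labellings, count and distance add up to the same
    \<open>card A\<close>, so the comparison is reversed.\<close>
  then have less_iff: "card (satisfied_weak A ?W L') < card (satisfied_weak A ?W L'')
      \<longleftrightarrow> distance A L L'' < distance A L L'"
    if "L g \<noteq> L' g" and "L g \<noteq> L'' g" for L' L''
    using card_satisfied_atoms[of A L g L'] card_satisfied_atoms[of A L g L''] that by linarith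
  have "satisfies_all A L' {Neg (Atom (atom_of L g))} \<longleftrightarrow> L g \<noteq> L' g" for L'
    using assms(2) by (simp add: satisfies_all_def satisfies_Neg satisfies_atom_of_iff)
  then show "counterfactuals \<sigma> A R g L = mc_labellings \<sigma> A R {Neg (Atom (atom_of L g))} ?W"
    unfolding counterfactuals_def mc_labellings_def using less_iff by blast
next
  let ?W = "{Neg (Atom (atom_of L a)) | a. a \<in> A - {g}}"
  have "satisfies_all A L' {Atom (atom_of L g)} \<longleftrightarrow> L g = L' g" for L'
    using assms(2) by (simp add: satisfies_all_def satisfies_atom_of_iff)
  moreover have "card (satisfied_weak A ?W L') = distance A L L'" if "L g = L' g" for L'
    using that by (rule card_satisfied_negated_atoms)
  ultimately show "semifactuals \<sigma> A R g L = mc_labellings \<sigma> A R {Atom (atom_of L g)} ?W"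
    unfolding semifactuals_def mc_labellings_def by auto
qed

end
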